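(* Let $u$ be a node and let $v\in\vartheta_u$ be a node in the communication set of $u$, $v\neq u$. Suppose $u$ and $v$ are allocated quorums $Q_u,Q_v$ of the grid quorum system $\Omega_g$ over a period of $m$ slots by the Quorum Selection algorithm. When the clocks are synchronous, $u$ and $v$ have at least $\left\lceil \frac{D_uD_v m}{2\varrho^2}\right\rceil$ rendezvous active time slots, i.e. $$|Q_u\cap Q_v|\ \ge\ \left\lceil \frac{D_uD_v m}{2\varrho^2}\right\rceil .$$
   Context: A period $T=\{\tau_1,\dots,\tau_m\}$ consists of $m$ time slots, where $\sqrt m$ is an integer. The communication set $\vartheta_u$ of a node $u$ is the set consisting of $u$ and all nodes in its communication range. Each node $u$ has a demand $D_u$ (amount of data to be transmitted or received per unit time), with $0<D_u\le\varrho$, where $\varrho>0$ is the data rate. Grid quorum system $\Omega_g$: the $m$ slots of $T$ are placed in row-major order in a $\sqrt m\times\sqrt m$ grid, rows and columns numbered $1,\dots,\sqrt m$. Put $r_u=\left\lceil\frac{D_u\sqrt m}{2\varrho}\right\rceil$. A quorum for node $u$ with index $i$, where $1\le i\le \sqrt m+1-r_u$, is the set of all slots lying in the $r_u$ consecutive rows starting from row $i$ or in the $r_u$ consecutive columns starting from column $i$ (so it contains $r_u$ full rows and $r_u$ full columns with the same indices). Quorum Selection algorithm (with a fixed parameter $K\ge1$): each node chooses the index $i$ of its quorum uniformly at random among the admissible indices; if the chosen quorum is occupied and it has made at most $K$ such retries, it puts that quorum in a list and chooses another quorum not in the list; the last quorum chosen is its quorum. Here a quorum $Q_i$ selected earlier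 than $Q_j$ is called occupied when $|Q_i\cap Q_j|>\left\lceil\frac{D_iD_jm}{2\varrho^2}\right\rceil$, where $D_i,D_j$ are the demands of the nodes involved. When clocks are synchronous, a node $u$ is active exactly in the slots of $Q_u$, and the rendezvous active time slots of $u$ and $v$ are the slots in $Q_u\cap Q_v$. *)

theory Defs
  imports "HOL-Probability.Probability_Mass_Function"
begin

definition comm_set :: "'n set \<Rightarrow> ('n \<Rightarrow> 'n \<Rightarrow> bool) \<Rightarrow> 'n \<Rightarrow> 'n set" where
  "comm_set V in_range u = insert u {v \<in> V. in_range u v}"

section \<open>The grid quorum system\<close>

text \<open>The slots \<open>\<tau>\<^sub>1, \<dots>, \<tau>\<^sub>m\<close> are represented by their indices.\<close>

definition slots :: "nat \<Rightarrow> nat set" where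
  "slots m = {1..m}"

text \<open>The floor is only a coercion to \<^typ>\<open>nat\<close>: \<open>m\<close> is meant to be a perfect square.\<close>

definition grid_side :: "nat \<Rightarrow> nat" where
  "grid_side m = nat \<lfloor>sqrt (real m)\<rfloor>"

definition slot_row :: "nat \<Rightarrow> nat \<Rightarrow> nat" where
  "slot_row m t = (t - 1) div grid_side m + 1"

definition slot_col :: "nat \<Rightarrow> nat \<Rightarrow> nat" where
  "slot_col m t = (t - 1) mod grid_side m + 1"

definition quorum_width :: "nat \<Rightarrow> real \<Rightarrow> real \<Rightarrow> nat" where
  "quorum_width m \<rho> d = nat \<lceil>d * sqrt (real m) / (2 * \<rho>)\<rceil>"

definition admissible_indices :: "nat \<Rightarrow> real \<Rightarrow> real \<Rightarrow> nat set" where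
  "admissible_indices m \<rho> d = {1..grid_side m + 1 - quorum_width m \<rho> d}"

definition grid_quorum :: "nat \<Rightarrow> real \<Rightarrow> real \<Rightarrow> nat \<Rightarrow> nat set" where
  "grid_quorum m \<rho> d i =
     (let I = {i..<i + quorum_width m \<rho> d}
      in {t \<in> slots m. slot_row m t \<in> I \<or> slot_col m t \<in> I})"

section \<open>Quorum Selection\<close>

text \<open>A partial map from nodes to quorums records the selections already made.\<close>

definition occupied ::
  "nat \<Rightarrow> real \<Rightarrow> ('n \<Rightarrow> real) \<Rightarrow> ('n \<rightharpoonup> nat set) \<Rightarrow> 'n \<Rightarrow> nat set \<Rightarrow> bool" where
  "occupied m \<rho> D earlier u A \<longleftrightarrow>
     (\<exists>w B. earlier w = Some B \<and>
        int (card (B \<inter> A)) > \<lceil>D w * D u * real m / (2 * \<rho>\<^sup>2)\<rceil>)"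

definition choices :: "nat \<Rightarrow> real \<Rightarrow> real \<Rightarrow> nat set list \<Rightarrow> nat set" where
  "choices m \<rho> d L = {i \<in> admissible_indices m \<rho> d. grid_quorum m \<rho> d i \<notin> set L}"

text \<open>
  The last two arguments are the number of retries still allowed and the list of rejected
  quorums. A node for which no quorum outside the list is left keeps the one chosen last.
\<close>

fun select_quorum ::
  "nat \<Rightarrow> real \<Rightarrow> ('n \<Rightarrow> real) \<Rightarrow> ('n \<rightharpoonup> nat set) \<Rightarrow> 'n \<Rightarrow> nat \<Rightarrow> nat set list \<Rightarrow> nat set pmf"
where
  "select_quorum m \<rho> D earlier u 0 L =
     map_pmf (grid_quorum m \<rho> (D u)) (pmf_of_set (choices m \<rho> (D u) L))"
| "select_quorum m \<rho> D earlier u (Suc k) L =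
     bind_pmf (pmf_of_set (choices m \<rho> (D u) L))
       (\<lambda>i. let A = grid_quorum m \<rho> (D u) i in
          if occupied m \<rho> D earlier u A \<and> choices m \<rho> (D u) (A # L) \<noteq> {}
          then select_quorum m \<rho> D earlier u k (A # L)
          else return_pmf A)"

fun select_quorums ::
  "nat \<Rightarrow> real \<Rightarrow> ('n \<Rightarrow> real) \<Rightarrow> nat \<Rightarrow> 'n list \<Rightarrow> ('n \<rightharpoonup> nat set) \<Rightarrow> ('n \<rightharpoonup> nat set) pmf"
where
  "select_quorums m \<rho> D K [] earlier = return_pmf earlier"
| "select_quorums m \<rho> D K (u # us) earlier =
     bind_pmf (select_quorum m \<rho> D earlier u K [])
       (\<lambda>A. select_quorums m \<rho> D K us (earlier(u \<mapsto> A)))"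

text \<open>
  The random allocation when the nodes select in the order given by the list; its support
  (\<^const>\<open>set_pmf\<close>) is the set of allocations that the algorithm can produce.
\<close>

definition quorum_selection ::
  "nat \<Rightarrow> real \<Rightarrow> ('n \<Rightarrow> real) \<Rightarrow> nat \<Rightarrow> 'n list \<Rightarrow> ('n \<rightharpoonup> nat set) pmf" where
  "quorum_selection m \<rho> D K ns = select_quorums m \<rho> D K ns Map.empty"

section \<open>Rendezvous with synchronous clocks\<close>

definition active_slots :: "('n \<rightharpoonup> nat set) \<Rightarrow> 'n \<Rightarrow> nat set" where
  "active_slots Q u = (case Q u of None \<Rightarrow> {} | Some A \<Rightarrow> A)"

definition rendezvous_slots :: "('n \<rightharpoonup> nat set) \<Rightarrow> 'n \<Rightarrow> 'n \<Rightarrow> nat set" where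
  "rendezvous_slots Q u v = active_slots Q u \<inter> active_slots Q v"

end

theory Submission
  imports Defs
begin

text \<open>
  Let \<open>s = \<surd>m\<close> and let \<open>p\<close>, \<open>q\<close> be the widths of the two quorums. A slot misses the intersection
  iff both of its coordinates lie outside the index interval \<open>I\<close> of the first quorum, or both lie
  outside the interval \<open>J\<close> of the second, so by inclusion-exclusion the intersection has
  \<open>s\<^sup>2 - (s - p)\<^sup>2 - (s - q)\<^sup>2 + (s - |I \<union> J|)\<^sup>2\<close> slots. If \<open>p + q \<le> s\<close>, this is at least
  \<open>2 p q\<close>, which suffices. As both demands are at most \<open>\<rho>\<close>, the only other case is
  \<open>p = q = (s + 1) / 2\<close>, where the first three terms already exceed \<open>s\<^sup>2 / 2\<close>.
\<close>

section \<open>Counting the common cells of two crosses in a square grid\<close>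

lemma card_cross_inter:
  fixes G I J :: "'a set"
  assumes "finite G" "I \<subseteq> G" "J \<subseteq> G"
  shows "int (card {(r, c) \<in> G \<times> G. (r \<in> I \<or> c \<in> I) \<and> (r \<in> J \<or> c \<in> J)}) =
    (int (card G))\<^sup>2 - (int (card G) - int (card I))\<^sup>2 - (int (card G) - int (card J))\<^sup>2
      + (int (card G) - int (card (I \<union> J)))\<^sup>2"
proof -
  define S where "S = {(r, c) \<in> G \<times> G. (r \<in> I \<or> c \<in> I) \<and> (r \<in> J \<or> c \<in> J)}"
  define sq :: "'a set \<Rightarrow> ('a \<times> 'a) set" where "sq A = (G - A) \<times> (G - A)" for A
  have card_sq: "int (card (sq A)) = (int (card G) - int (card A))\<^sup>2" if "A \<subseteq> G" for A
  proof -
    have "card (G - A) = card G - card A" "card A \<le> card G"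
      using that assms(1) by (auto intro: card_Diff_subset finite_subset card_mono)
    then show ?thesis
      by (simp add: sq_def card_cartesian_product of_nat_diff power2_eq_square)
  qed
  have fin: "finite S" "finite (sq A)" for A
    using assms(1) by (auto simp: S_def sq_def intro: finite_subset[of _ "G \<times> G"])
  have "card (G \<times> G) = card S + card (sq I \<union> sq J)"
  proof -
    have "G \<times> G = S \<union> (sq I \<union> sq J)" "S \<inter> (sq I \<union> sq J) = {}"
      by (auto simp: S_def sq_def)
    then show ?thesis
      using fin by (simp add: card_Un_disjoint)
  qed
  \<comment> \<open>\<open>sq A\<close> is the complement of the cross over \<open>A\<close>. Two
    such complements again meet in a set of this form, so inclusion-exclusion closes up with
    \<open>I \<union> J\<close>.\<close>
  moreover have "card (sq I) + card (sq J) = card (sq I \<union> sq J) + card (sq (I \<union> J))"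
  proof -
    have "sq I \<inter> sq J = sq (I \<union> J)"
      by (auto simp: sq_def)
    then show ?thesis
      using card_Un_Int[OF fin(2) fin(2), of I J] by simp
  qed
  ultimately have "int (card S) =
      int (card (G \<times> G)) - int (card (sq I)) - int (card (sq J)) + int (card (sq (I \<union> J)))"
    by linarith
  moreover have "int (card (G \<times> G)) = (int (card G))\<^sup>2"
    by (simp add: card_cartesian_product power2_eq_square)
  ultimately show ?thesis
    using assms by (simp add: card_sq S_def)
qed

text \<open>The reals \<open>a\<close> and \<open>b\<close> stand for the quorum widths before
  rounding. The position of the index sets enters only through the size of their union, and the
  worst case over that size is taken.\<close>

lemma ceiling_le_card_cross_inter:
  fixes G I J :: "'a set" and a b :: real
  assumes "finite G" "G \<noteq> {}" "I \<subseteq> G" "J \<subseteq> G"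
    and I: "int (card I) = \<lceil>a\<rceil>" and J: "int (card J) = \<lceil>b\<rceil>"
    and a: "0 \<le> a" "2 * a \<le> real (card G)" and b: "0 \<le> b" "2 * b \<le> real (card G)"
  shows "\<lceil>2 * a * b\<rceil> \<le>
    int (card {(r, c) \<in> G \<times> G. (r \<in> I \<or> c \<in> I) \<and> (r \<in> J \<or> c \<in> J)})"
proof -
  define s p q w where "s = int (card G)" and "p = int (card I)" and "q = int (card J)"
    and "w = int (card (I \<union> J))"
  have w: "w \<le> p + q"
    using card_Un_le[of I J] by (simp add: w_def p_def q_def flip: of_nat_add)
  have s: "1 \<le> s"
    using assms(1,2) by (simp add: s_def Suc_le_eq card_gt_0_iff)
  \<comment> \<open>Rounding up adds less than 1, so \<open>2 * a \<le> s\<close> gives a strict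
    bound by \<open>s + 2\<close>, which integrality sharpens to \<open>s + 1\<close>.\<close>
  have "2 * real_of_int p < real_of_int s + 2" "2 * real_of_int q < real_of_int s + 2"
    using I J a b unfolding p_def q_def s_def by linarith+
  then have pq: "2 * p \<le> s + 1" "2 * q \<le> s + 1"
    by linarith+
  have "2 * a * b \<le> real_of_int (s\<^sup>2 - (s - p)\<^sup>2 - (s - q)\<^sup>2 + (s - w)\<^sup>2)"
  proof (cases "p + q \<le> s")
    case True
    have "a \<le> real_of_int p" "b \<le> real_of_int q"
      using I J by (simp_all add: p_def q_def)
    then have "a * b \<le> real_of_int p * real_of_int q"
      using a b by (intro mult_mono) auto
    then have "2 * a * b \<le> real_of_int (2 * p * q)"
      by simp
    also have "2 * p * q \<le> s\<^sup>2 - (s - p)\<^sup>2 - (s - q)\<^sup>2 + (s - w)\<^sup>2"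
    proof -
      \<comment> \<open>Both bases are nonnegative because \<open>w \<le> p + q \<le> s\<close>. In
        the extreme case \<open>w = p + q\<close> of disjoint index sets the expression equals
        \<open>2 * p * q\<close> exactly.\<close>
      have "(s - p - q)\<^sup>2 \<le> (s - w)\<^sup>2"
        using True w by (intro power_mono) auto
      then show ?thesis
        by (simp add: power2_eq_square algebra_simps)
    qed
    finally show ?thesis
      by simp
  next
    case False
    \<comment> \<open>From \<open>s + 1 \<le> p + q\<close> and the two bounds by
      \<open>s + 1\<close>, both bounds must be equalities.\<close>
    with pq have p: "s = 2 * p - 1" "q = p"
      by auto
    have "(2 * a) * (2 * b) \<le> real_of_int s * real_of_int s"
      using a b by (intro mult_mono) (auto simp: s_def)
    then have "2 * (2 * a * b) \<le> real_of_int (s\<^sup>2)"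
      by (simp add: power2_eq_square)
    also have "s\<^sup>2 \<le> 2 * (s\<^sup>2 - (s - p)\<^sup>2 - (s - q)\<^sup>2 + (s - w)\<^sup>2)"
    proof -
      define A where "A = s\<^sup>2 - (s - p)\<^sup>2 - (s - q)\<^sup>2"
      \<comment> \<open>Here \<open>s - p = s - q = p - 1\<close>, so doubling gives
        \<open>2 * s\<^sup>2 - (s - 1)\<^sup>2\<close>, that is
        \<open>s\<^sup>2 + 2 * s - 1\<close>.\<close>
      have "2 * A = s\<^sup>2 + (4 * p - 3)"
        unfolding A_def p by (simp add: power2_eq_square algebra_simps)
      also have "s\<^sup>2 + (4 * p - 3) \<ge> s\<^sup>2"
        using s p by simp
      finally show ?thesis
        unfolding A_def[symmetric] distrib_left by (simp add: add_increasing2)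
    qed
    finally show ?thesis
      by simp
  qed
  then show ?thesis
    using card_cross_inter[OF assms(1,3,4)]
    by (simp add: ceiling_le_iff s_def p_def q_def w_def)
qed

section \<open>Slots as cells of the grid\<close>

lemma grid_side:
  assumes "sqrt (real m) \<in> \<int>"
  shows "real (grid_side m) = sqrt (real m)" and "m = grid_side m * grid_side m"
proof -
  show *: "real (grid_side m) = sqrt (real m)"
    using assms by (auto simp: grid_side_def elim!: Ints_cases)
  have "real (grid_side m * grid_side m) = real m"
    unfolding of_nat_mult * by simp
  then show "m = grid_side m * grid_side m"
    by linarith
qed

lemma bij_betw_slots_grid:
  assumes "m = grid_side m * grid_side m"
  shows "bij_betw (\<lambda>t. (slot_row m t, slot_col m t)) (slots m)
    ({1..grid_side m} \<times> {1..grid_side m})"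
proof (cases "grid_side m = 0")
  case True
  then show ?thesis
    using assms by (simp add: slots_def bij_betw_def)
next
  case False
  define s where "s = grid_side m"
  have s: "0 < s" "m = s * s"
    using False assms by (auto simp: s_def)
  have "bij_betw (\<lambda>t. ((t - 1) div s + 1, (t - 1) mod s + 1)) {1..m} ({1..s} \<times> {1..s})"
  \<comment> \<open>The inverse is the row-major number of a cell: \<open>r - 1\<close> full rows of
    length \<open>s\<close> come before row \<open>r\<close>.\<close>
  proof (rule bij_betw_byWitness[where f' = "\<lambda>(r, c). (r - 1) * s + c"])
    show "(\<lambda>t. ((t - 1) div s + 1, (t - 1) mod s + 1)) ` {1..m} \<subseteq> {1..s} \<times> {1..s}"
      using s by (auto simp: Suc_le_eq less_mult_imp_div_less)
    show "(\<lambda>(r, c). (r - 1) * s + c) ` ({1..s} \<times> {1..s}) \<subseteq> {1..m}"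
    proof -
      have "1 \<le> (r - 1) * s + c \<and> (r - 1) * s + c \<le> m" if "r \<in> {1..s}" "c \<in> {1..s}" for r c
      proof -
        have "(r - 1) * s + c \<le> (r - 1) * s + s"
          using that by simp
        also have "\<dots> = r * s"
          using that by (simp add: algebra_simps)
        also have "\<dots> \<le> m"
          using that s by simp
        finally show ?thesis
          using that by simp
      qed
      then show ?thesis
        by (simp add: image_subset_iff)
    qed
    show "\<forall>t\<in>{1..m}. (case ((t - 1) div s + 1, (t - 1) mod s + 1) of
        (r, c) \<Rightarrow> (r - 1) * s + c) = t"
      by simp
    show "\<forall>z\<in>{1..s} \<times> {1..s}. (((case z of (r, c) \<Rightarrow> (r - 1) * s + c) - 1) div s + 1,
        ((case z of (r, c) \<Rightarrow> (r - 1) * s + c) - 1) mod s + 1) = z"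
    proof clarsimp
      fix r c assume rc: "Suc 0 \<le> r" "r \<le> s" "Suc 0 \<le> c" "c \<le> s"
      \<comment> \<open>Zero-based coordinates remove the truncated subtractions and leave division
        of \<open>r' * s + c'\<close> by \<open>s\<close> with \<open>c' < s\<close>.\<close>
      obtain r' c' where "r = Suc r'" "c = Suc c'"
        using rc by (metis Suc_le_D One_nat_def)
      then show "Suc (((r - Suc 0) * s + c - Suc 0) div s) = r \<and>
          Suc (((r - Suc 0) * s + c - Suc 0) mod s) = c"
        using rc by simp
    qed
  qed
  then show ?thesis
    by (simp add: slots_def slot_row_def slot_col_def s_def)
qed

text \<open>The row-column map is a bijection from slots to cells, so it carries the two quorums to
  crosses without changing the size of their intersection.\<close>

lemma card_grid_quorum_inter:
  fixes m i j :: nat and \<rho> d e :: real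
  assumes "sqrt (real m) \<in> \<int>"
  defines "G \<equiv> {1..grid_side m}"
    and "I \<equiv> {i..<i + quorum_width m \<rho> d}" and "J \<equiv> {j..<j + quorum_width m \<rho> e}"
  shows "card (grid_quorum m \<rho> d i \<inter> grid_quorum m \<rho> e j) =
    card {(r, c) \<in> G \<times> G. (r \<in> I \<or> c \<in> I) \<and> (r \<in> J \<or> c \<in> J)}"
proof -
  define f where "f t = (slot_row m t, slot_col m t)" for t
  define S where "S = {(r, c) \<in> G \<times> G. (r \<in> I \<or> c \<in> I) \<and> (r \<in> J \<or> c \<in> J)}"
  have f: "bij_betw f (slots m) (G \<times> G)"
    unfolding f_def G_def using bij_betw_slots_grid grid_side(2) assms(1) by blast
  have Q: "grid_quorum m \<rho> d i \<inter> grid_quorum m \<rho> e j = {t \<in> slots m. f t \<in> S}"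
    using bij_betwE[OF f] by (auto simp: grid_quorum_def Let_def f_def S_def I_def J_def)
  have "f ` {t \<in> slots m. f t \<in> S} = S"
  proof -
    have "S \<subseteq> f ` slots m"
      using bij_betw_imp_surj_on[OF f] by (auto simp: S_def)
    then show ?thesis
      by blast
  qed
  moreover have "inj_on f {t \<in> slots m. f t \<in> S}"
    using bij_betw_imp_inj_on[OF f] by (rule inj_on_subset) auto
  ultimately show ?thesis
    unfolding Q S_def[symmetric] by (metis card_image)
qed

lemma ceiling_le_card_grid_quorum_inter:
  assumes m: "m > 0" "sqrt (real m) \<in> \<int>" and "\<rho> > 0"
    and d: "0 < d" "d \<le> \<rho>" and e: "0 < e" "e \<le> \<rho>"
    and i: "i \<in> admissible_indices m \<rho> d" and j: "j \<in> admissible_indices m \<rho> e"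
  shows "\<lceil>d * e * real m / (2 * \<rho>\<^sup>2)\<rceil>
    \<le> int (card (grid_quorum m \<rho> d i \<inter> grid_quorum m \<rho> e j))"
proof -
  define s where "s = real (grid_side m)"
  have s: "s = sqrt (real m)"
    using grid_side(1)[OF m(2)] by (simp add: s_def)
  have "0 < s"
    using m(1) by (simp add: s)
  define a where "a = (\<lambda>d. d * s / (2 * \<rho>))"
  have width: "int (quorum_width m \<rho> d) = \<lceil>a d\<rceil>" if "0 < d" for d
  proof -
    have "0 \<le> a d"
      using that \<open>0 < s\<close> \<open>\<rho> > 0\<close> by (simp add: a_def)
    \<comment> \<open>This is the condition under which the ceiling is nonnegative, so that the
      coercion by \<open>nat\<close> is harmless.\<close>
    then have "- 1 < a d"
      by linarith
    then show ?thesis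
      by (simp add: quorum_width_def a_def s)
  qed
  have a: "0 \<le> a d" "2 * a d \<le> s" if "0 < d" "d \<le> \<rho>" for d
    using that \<open>0 < s\<close> \<open>\<rho> > 0\<close> by (auto simp: a_def field_simps)
  have "real m = s * s"
    by (simp add: s)
  then have "d * e * real m / (2 * \<rho>\<^sup>2) = 2 * a d * a e"
    using \<open>\<rho> > 0\<close> by (simp add: a_def power2_eq_square field_simps)
  \<comment> \<open>Admissibility means index plus width is at most side plus one, which keeps both
    index intervals inside the grid.\<close>
  also have "\<lceil>2 * a d * a e\<rceil> \<le> int (card (grid_quorum m \<rho> d i \<inter> grid_quorum m \<rho> e j))"
    unfolding card_grid_quorum_inter[OF m(2)]
    using i j d e a[OF d] a[OF e] \<open>0 < s\<close>
    by (intro ceiling_le_card_cross_inter)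
       (auto simp: admissible_indices_def width s_def)
  finally show ?thesis .
qed

section \<open>Possible outcomes of the selection algorithm\<close>

lemma admissible_indices_nonempty:
  assumes "m > 0" "sqrt (real m) \<in> \<int>" "\<rho> > 0" "d \<le> \<rho>"
  shows "admissible_indices m \<rho> d \<noteq> {}"
proof -
  \<comment> \<open>The unrounded width is at most half the side, so the rounded one is at most the
    side and index 1 is admissible.\<close>
  have "d * sqrt (real m) / (2 * \<rho>) \<le> sqrt (real m) / 2"
    using assms mult_right_mono[of d \<rho> "sqrt (real m)"] by (simp add: field_simps)
  also have "\<dots> \<le> real (grid_side m)"
    using grid_side(1)[OF assms(2)] by simp
  finally have "quorum_width m \<rho> d \<le> grid_side m"
    by (simp add: quorum_width_def ceiling_le_iff nat_le_iff)
  then show ?thesis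
    by (simp add: admissible_indices_def)
qed

text \<open>The intersection bound holds for any two admissible quorums, so from the algorithm it
  suffices to know that each outcome is one.\<close>

lemma set_pmf_select_quorum_subset:
  assumes "choices m \<rho> (D u) L \<noteq> {}"
  shows "set_pmf (select_quorum m \<rho> D earlier u k L)
    \<subseteq> grid_quorum m \<rho> (D u) ` admissible_indices m \<rho> (D u)"
  using assms
proof (induction k arbitrary: L)
  case (0 L)
  have "finite (choices m \<rho> (D u) L)"
    by (simp add: choices_def admissible_indices_def)
  then show ?case
    using 0 by (auto simp: choices_def)
next
  case (Suc k L)
  have "finite (choices m \<rho> (D u) L)"
    by (simp add: choices_def admissible_indices_def)
  then have "set_pmf (pmf_of_set (choices m \<rho> (D u) L)) \<subseteq> admissible_indices m \<rho> (D u)"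
    using Suc.prems by (auto simp: choices_def)
  then show ?case
    \<comment> \<open>A retry happens only if a choice outside the extended list remains, which is
      the premise of the induction hypothesis.\<close>
    using Suc.IH by (fastforce simp: Let_def split: if_splits)
qed

text \<open>Invariant of the run: all recorded quorums are admissible. Each selection moves a node
  from the list to the domain of the map, so \<open>set ns \<union> dom earlier\<close> stays the
  same.\<close>

lemma select_quorums_admissible:
  assumes "Q \<in> set_pmf (select_quorums m \<rho> D K ns earlier)"
    and "\<And>w. w \<in> set ns \<Longrightarrow> admissible_indices m \<rho> (D w) \<noteq> {}"
    and "\<And>w A. earlier w = Some A \<Longrightarrow>
      A \<in> grid_quorum m \<rho> (D w) ` admissible_indices m \<rho> (D w)"
    and "w \<in> set ns \<union> dom earlier"
  shows "\<exists>i \<in> admissible_indices m \<rho> (D w). Q w = Some (grid_quorum m \<rho> (D w) i)"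
  using assms
proof (induction ns arbitrary: earlier)
  case Nil
  then show ?case
    by fastforce
next
  case (Cons u us)
  then obtain A where A: "A \<in> set_pmf (select_quorum m \<rho> D earlier u K [])"
    and Q: "Q \<in> set_pmf (select_quorums m \<rho> D K us (earlier(u \<mapsto> A)))"
    by auto
  \<comment> \<open>The support of \<open>pmf_of_set\<close> is known only for nonempty finite sets.
    With nothing rejected yet, all admissible indices are available.\<close>
  have "choices m \<rho> (D u) [] \<noteq> {}"
    using Cons.prems(2)[of u] by (simp add: choices_def)
  then have "A \<in> grid_quorum m \<rho> (D u) ` admissible_indices m \<rho> (D u)"
    using A set_pmf_select_quorum_subset[of m \<rho> D u "[]" earlier K] by auto
  with Cons.prems show ?case
    by (intro Cons.IH[OF Q]) (auto split: if_splits)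
qed

theorem lemma2:
  fixes V :: "'n set" and in_range :: "'n \<Rightarrow> 'n \<Rightarrow> bool"
    and D :: "'n \<Rightarrow> real" and \<rho> :: real and m K :: nat
    and ns :: "'n list" and Q :: "'n \<rightharpoonup> nat set" and u v :: 'n
  assumes "m > 0" and "sqrt (real m) \<in> \<int>"
    and "\<rho> > 0" and "\<And>w. w \<in> V \<Longrightarrow> 0 < D w \<and> D w \<le> \<rho>"
    and "K \<ge> 1"
    and "set ns = V" and "distinct ns"
    and "Q \<in> set_pmf (quorum_selection m \<rho> D K ns)"
    and "u \<in> V" and "v \<in> comm_set V in_range u" and "v \<noteq> u"
  shows "int (card (rendezvous_slots Q u v)) \<ge> \<lceil>D u * D v * real m / (2 * \<rho>\<^sup>2)\<rceil>"
proof -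
  have allocated: "\<exists>i \<in> admissible_indices m \<rho> (D w). Q w = Some (grid_quorum m \<rho> (D w) i)"
    if "w \<in> V" for w
  proof (rule select_quorums_admissible[where D = D and ns = ns and earlier = Map.empty])
    show "Q \<in> set_pmf (select_quorums m \<rho> D K ns Map.empty)"
      using assms(8) by (simp add: quorum_selection_def)
    show "admissible_indices m \<rho> (D w) \<noteq> {}" if "w \<in> set ns" for w
      using that assms(1-4,6) by (intro admissible_indices_nonempty) auto
  qed (use that assms(6) in auto)
  have "v \<in> V"
    using assms(10,11) by (auto simp: comm_set_def)
  obtain i j where "i \<in> admissible_indices m \<rho> (D u)" "Q u = Some (grid_quorum m \<rho> (D u) i)"
    and "j \<in> admissible_indices m \<rho> (D v)" "Q v = Some (grid_quorum m \<rho> (D v) j)"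
    using allocated \<open>u \<in> V\<close> \<open>v \<in> V\<close> by blast
  then show ?thesis
    using ceiling_le_card_grid_quorum_inter assms(1-4) \<open>u \<in> V\<close> \<open>v \<in> V\<close>
    by (simp add: rendezvous_slots_def active_slots_def)
qed

end
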